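(* Let $p\in\mathbb{N}$ and assume that $\boldsymbol{U}^p=(U_{i,K}^p)_{K\in\mathcal{T},0\le i\le n}$ satisfies the volume-filling constraint $\sum_{j=0}^nU_{j,K}^p=1$ for any $K\in\mathcal{T}$. Then any solution $\boldsymbol{U}^{p+1}$ to the scheme satisfies it as well, i.e. $\sum_{j=0}^nU_{j,K}^{p+1}=1$ for any $K\in\mathcal{T}$.
   Context: Parameters: $n\ge1$; $\Omega\subset\mathbb{R}^d$, $d\in\{1,2,3\}$, a bounded domain; $\varepsilon,\beta>0$; $K_{ij}=K_{ji}>0$ for $0\le i\ne j\le n$. Mesh: $\Omega$ carries an admissible mesh $(\mathcal{T},\mathcal{E},(x_K)_{K\in\mathcal{T}})$. $\mathcal{T}$ is a finite set of non-empty, open, polyhedral, convex, pairwise disjoint cells with $\bigcup_K\overline K=\overline\Omega$. $\mathcal{E}$ is a set of closed faces contained in hyperplanes, of $(d-1)$-dimensional Hausdorff measure $m_\sigma>0$, with pairwise intersections of zero $(d-1)$-measure; $\partial K=\bigcup_{\sigma\in\mathcal{E}_K}\sigma$ with $\mathcal{E}_K\subset\mathcal{E}$, and $\bigcup_K\mathcal{E}_K=\mathcal{E}$; for distinct $K,L$, $\overline K\cap\overline L$ is either a single face, denoted $K|L$, or has zero $(d-1)$-measure. The centers satisfy $x_K\in K$ and $x_L-x_K\perp K|L$. $m_K$ is the Lebesgue measure of $K$; $\mathcal{E}_{\rm int}$ is the set of faces $\sigma=K|L$ and $\mathcal{E}_{K,\rm int}=\mathcal{E}_K\cap\mathcal{E}_{\rm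 int}$; the other faces are exterior (contained in $\partial\Omega$). For $\sigma=K|L$: $\tau_\sigma=m_\sigma/|x_K-x_L|$. For $\boldsymbol{V}=(V_K)_{K\in\mathcal{T}}$ and $\sigma\in\mathcal{E}_K$: $V_{K\sigma}=V_L$ if $\sigma=K|L$, $V_{K\sigma}=V_K$ if $\sigma$ is exterior; $D_{K\sigma}\boldsymbol{V}=V_{K\sigma}-V_K$. Scheme: $\Delta t_p>0$ is the time step between iterates $p$ and $p+1$. Given $\boldsymbol{U}^p=(U_{i,K}^p)_{K\in\mathcal{T},0\le i\le n}$, a solution $\boldsymbol{U}^{p+1}$ satisfies, for all $K\in\mathcal{T}$, $i=0,\dots,n$, $$m_K\frac{U_{i,K}^{p+1}-U_{i,K}^p}{\Delta t_p}+\sum_{\sigma\in\mathcal{E}_{K,\rm int}}J_{i,K\sigma}^{p+1}=0,$$ where, with $\boldsymbol{U}_i=(U_{i,K})_K$, $$J_{i,K\sigma}^{p+1}=-\tau_\sigma\sum_{0\le j\ne i\le n}K_{ij}\big(U_{j,\sigma}^{p+1}D_{K\sigma}\boldsymbol{U}_i^{p+1}-U_{i,\sigma}^{p+1}D_{K\sigma}\boldsymbol{U}_j^{p+1}\big)+\tau_\sigma K_{i0}U_{i,\sigma}^{p+1}U_{0,\sigma}^{p+1}D_{K\sigma}\boldsymbol{W}_0^{p+1/2},\quad i=1,\dots,n,$$ $$J_{0,K\sigma}^{p+1}=-\tau_\sigma\sum_{i=1}^nK_{i0}\big(U_{i,\sigma}^{p+1}D_{K\sigma}\boldsymbol{U}_0^{p+1}-U_{0,\sigma}^{p+1}D_{K\sigma}\boldsymbol{U}_i^{p+1}\big)-\tau_\sigma\sum_{i=1}^nK_{i0}U_{i,\sigma}^{p+1}U_{0,\sigma}^{p+1}D_{K\sigma}\boldsymbol{W}_0^{p+1/2},$$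 $$W_{0,K}^{p+1/2}=-\frac{\varepsilon}{m_K}\sum_{\sigma\in\mathcal{E}_{K,\rm int}}\tau_\sigma D_{K\sigma}\boldsymbol{U}_0^{p+1}+\beta(1-2U_{0,K}^p),$$ and the edge values are $U_{i,\sigma}^{p+1}=0$ if $\min(U_{i,K}^{p+1},U_{i,K\sigma}^{p+1})\le0$; $U_{i,\sigma}^{p+1}=U_{i,K}^{p+1}$ if $0<U_{i,K}^{p+1}=U_{i,K\sigma}^{p+1}$; and $U_{i,\sigma}^{p+1}=\frac{U_{i,K}^{p+1}-U_{i,K\sigma}^{p+1}}{\ln U_{i,K}^{p+1}-\ln U_{i,K\sigma}^{p+1}}$ otherwise. *)

theory Defs
  imports "HOL-Analysis.Analysis"
begin

text \<open>
  The \<open>s\<close>-dimensional Hausdorff (outer) measure, normalised by the volume of the \<open>s\<close>-dimensional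
  unit ball so that it agrees with Lebesgue measure on \<open>s\<close>-dimensional planes. Empty covering sets
  contribute nothing; this matters only for \<open>s = 0\<close>, where the result is the counting measure.
\<close>

definition hausdorff_weight :: "nat \<Rightarrow> 'a::metric_space set \<Rightarrow> real" where
  "hausdorff_weight s C = (if C = {} then 0 else unit_ball_vol (real s) * (diameter C / 2) ^ s)"

definition hausdorff_premeasure :: "nat \<Rightarrow> real \<Rightarrow> 'a::metric_space set \<Rightarrow> ennreal" where
  "hausdorff_premeasure s \<delta> A =
     (INF C \<in> {C :: nat \<Rightarrow> 'a set. A \<subseteq> (\<Union>k. C k) \<and> (\<forall>k. bounded (C k) \<and> diameter (C k) \<le> \<delta>)}.
        \<Sum>k. ennreal (hausdorff_weight s (C k)))"

definition hausdorff_measure :: "nat \<Rightarrow> 'a::metric_space set \<Rightarrow> ennreal" where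
  "hausdorff_measure s A = (SUP \<delta> \<in> {0<..}. hausdorff_premeasure s \<delta> A)"

abbreviation face_measure :: "(real ^ 'd) set \<Rightarrow> ennreal" where
  "face_measure \<equiv> hausdorff_measure (CARD('d) - 1)"

text \<open>
  The face sets \<open>\<E>\<^sub>K\<close> and the centers are data of the mesh; their values matter only at
  arguments that are cells of the mesh.
\<close>

record 'd mesh =
  cells :: "(real ^ 'd) set set"
  faces :: "(real ^ 'd) set set"
  cell_faces :: "(real ^ 'd) set \<Rightarrow> (real ^ 'd) set set"
  center :: "(real ^ 'd) set \<Rightarrow> real ^ 'd"

text \<open>\<open>is_interface M K L \<sigma>\<close> expresses \<open>\<sigma> = K|L\<close>.\<close>

definition is_interface ::
    "'d::finite mesh \<Rightarrow> (real ^ 'd) set \<Rightarrow> (real ^ 'd) set \<Rightarrow> (real ^ 'd) set \<Rightarrow> bool" where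
  "is_interface M K L \<sigma> \<longleftrightarrow>
     K \<in> cells M \<and> L \<in> cells M \<and> K \<noteq> L \<and> \<sigma> \<in> faces M \<and> \<sigma> = closure K \<inter> closure L"

definition int_faces :: "'d::finite mesh \<Rightarrow> (real ^ 'd) set set" where
  "int_faces M = {\<sigma>. \<exists>K L. is_interface M K L \<sigma>}"

definition cell_int_faces :: "'d::finite mesh \<Rightarrow> (real ^ 'd) set \<Rightarrow> (real ^ 'd) set set" where
  "cell_int_faces M K = cell_faces M K \<inter> int_faces M"

definition admissible_mesh :: "(real ^ 'd::finite) set \<Rightarrow> 'd mesh \<Rightarrow> bool" where
  "admissible_mesh \<Omega> M \<longleftrightarrow>
     finite (cells M) \<and>
     (\<forall>K\<in>cells M. K \<noteq> {} \<and> open K \<and> convex K \<and> polyhedron (closure K)) \<and>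
     pairwise disjnt (cells M) \<and>
     (\<Union>K\<in>cells M. closure K) = closure \<Omega> \<and>
     (\<forall>\<sigma>\<in>faces M. closed \<sigma> \<and> (\<exists>a b. a \<noteq> 0 \<and> \<sigma> \<subseteq> {y. a \<bullet> y = b}) \<and> 0 < face_measure \<sigma>) \<and>
     (\<forall>\<sigma>\<in>faces M. \<forall>\<sigma>'\<in>faces M. \<sigma> \<noteq> \<sigma>' \<longrightarrow> face_measure (\<sigma> \<inter> \<sigma>') = 0) \<and>
     (\<forall>K\<in>cells M. cell_faces M K \<subseteq> faces M \<and> frontier K = \<Union>(cell_faces M K)) \<and>
     (\<Union>K\<in>cells M. cell_faces M K) = faces M \<and>
     (\<forall>K\<in>cells M. \<forall>L\<in>cells M. K \<noteq> L \<longrightarrow>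
        closure K \<inter> closure L \<in> faces M \<or> face_measure (closure K \<inter> closure L) = 0) \<and>
     (\<forall>\<sigma> \<in> faces M - int_faces M. \<sigma> \<subseteq> frontier \<Omega>) \<and>
     (\<forall>K\<in>cells M. center M K \<in> K) \<and>
     (\<forall>K L \<sigma>. is_interface M K L \<sigma> \<longrightarrow>
        (\<forall>y\<in>\<sigma>. \<forall>z\<in>\<sigma>. orthogonal (center M L - center M K) (y - z)))"

text \<open>
  In an admissible mesh an interior face separates exactly two cells: it is convex with positive
  \<open>(d-1)\<close>-measure, so two distinct cells on the same side of its hyperplane would overlap.
  Hence the definite descriptions below are well defined.
\<close>

definition transmissibility :: "'d::finite mesh \<Rightarrow> (real ^ 'd) set \<Rightarrow> real" where
  "transmissibility M \<sigma> =
     (THE t. \<exists>K L. is_interface M K L \<sigma> \<and>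
        t = enn2real (face_measure \<sigma>) / dist (center M K) (center M L))"

definition across ::
    "'d::finite mesh \<Rightarrow> ((real ^ 'd) set \<Rightarrow> real) \<Rightarrow> (real ^ 'd) set \<Rightarrow> (real ^ 'd) set \<Rightarrow> real" where
  "across M V K \<sigma> = (if \<sigma> \<in> int_faces M then V (THE L. is_interface M K L \<sigma>) else V K)"

definition face_diff ::
    "'d::finite mesh \<Rightarrow> ((real ^ 'd) set \<Rightarrow> real) \<Rightarrow> (real ^ 'd) set \<Rightarrow> (real ^ 'd) set \<Rightarrow> real" where
  "face_diff M V K \<sigma> = across M V K \<sigma> - V K"

definition log_mean :: "real \<Rightarrow> real \<Rightarrow> real" where
  "log_mean a b =
     (if min a b \<le> 0 then 0 else if a = b then a else (a - b) / (ln a - ln b))"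

definition edge_value ::
    "'d::finite mesh \<Rightarrow> ((real ^ 'd) set \<Rightarrow> real) \<Rightarrow> (real ^ 'd) set \<Rightarrow> (real ^ 'd) set \<Rightarrow> real" where
  "edge_value M V K \<sigma> = log_mean (V K) (across M V K \<sigma>)"

text \<open>
  A discrete state \<open>U :: nat \<Rightarrow> (real ^ 'd) set \<Rightarrow> real\<close> maps a species \<open>i \<in> {0..n}\<close> and a cell to the
  value \<open>U\<^bsub>i,K\<^esub>\<close>. Below, \<open>U\<close> is the state at step \<open>p\<close>, \<open>V\<close> the one at step \<open>p + 1\<close>, and
  \<open>W\<close> the intermediate potential.
\<close>

definition potential ::
    "'d::finite mesh \<Rightarrow> real \<Rightarrow> real \<Rightarrow> (nat \<Rightarrow> (real ^ 'd) set \<Rightarrow> real) \<Rightarrow>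
     (nat \<Rightarrow> (real ^ 'd) set \<Rightarrow> real) \<Rightarrow> (real ^ 'd) set \<Rightarrow> real" where
  "potential M \<epsilon> \<beta> U V K =
     - (\<epsilon> / measure lebesgue K) *
         (\<Sum>\<sigma>\<in>cell_int_faces M K. transmissibility M \<sigma> * face_diff M (V 0) K \<sigma>)
     + \<beta> * (1 - 2 * U 0 K)"

definition flux ::
    "'d::finite mesh \<Rightarrow> nat \<Rightarrow> (nat \<Rightarrow> nat \<Rightarrow> real) \<Rightarrow> (nat \<Rightarrow> (real ^ 'd) set \<Rightarrow> real) \<Rightarrow>
     ((real ^ 'd) set \<Rightarrow> real) \<Rightarrow> nat \<Rightarrow> (real ^ 'd) set \<Rightarrow> (real ^ 'd) set \<Rightarrow> real" where
  "flux M n \<kappa> V W i K \<sigma> =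
     (if i = 0 then
        - transmissibility M \<sigma> * (\<Sum>j=1..n. \<kappa> j 0 *
            (edge_value M (V j) K \<sigma> * face_diff M (V 0) K \<sigma>
             - edge_value M (V 0) K \<sigma> * face_diff M (V j) K \<sigma>))
        - transmissibility M \<sigma> * (\<Sum>j=1..n. \<kappa> j 0 *
            edge_value M (V j) K \<sigma> * edge_value M (V 0) K \<sigma> * face_diff M W K \<sigma>)
      else
        - transmissibility M \<sigma> * (\<Sum>j\<in>{0..n} - {i}. \<kappa> i j *
            (edge_value M (V j) K \<sigma> * face_diff M (V i) K \<sigma>
             - edge_value M (V i) K \<sigma> * face_diff M (V j) K \<sigma>))
        + transmissibility M \<sigma> * \<kappa> i 0 *
            edge_value M (V i) K \<sigma> * edge_value M (V 0) K \<sigma> * face_diff M W K \<sigma>)"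

definition scheme_step ::
    "'d::finite mesh \<Rightarrow> nat \<Rightarrow> (nat \<Rightarrow> nat \<Rightarrow> real) \<Rightarrow> real \<Rightarrow> real \<Rightarrow> real \<Rightarrow>
     (nat \<Rightarrow> (real ^ 'd) set \<Rightarrow> real) \<Rightarrow> (nat \<Rightarrow> (real ^ 'd) set \<Rightarrow> real) \<Rightarrow> bool" where
  "scheme_step M n \<kappa> \<epsilon> \<beta> \<Delta>t U V \<longleftrightarrow>
     (\<forall>K\<in>cells M. \<forall>i\<in>{0..n}.
        measure lebesgue K * ((V i K - U i K) / \<Delta>t)
        + (\<Sum>\<sigma>\<in>cell_int_faces M K. flux M n \<kappa> V (potential M \<epsilon> \<beta> U V) i K \<sigma>) = 0)"

end

theory Submission
  imports Defs
begin

text \<open>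
  Summing the scheme over all species cancels every flux, already on each single face of a
  single cell: the exchange term between species \<open>i\<close> and \<open>j\<close> is antisymmetric under swapping
  \<open>i\<close> and \<open>j\<close> because \<open>\<kappa>\<close> is symmetric (\<open>sum_antisymmetric_exchange_eq_0\<close>), and the drift
  term of species \<open>0\<close> is by construction minus the sum of the drift terms of all other species
  (\<open>sum_flux_eq_0\<close>). What remains of the summed scheme on a cell \<open>K\<close> is
  \<open>m\<^sub>K / \<Delta>t\<close> times the increment of the total volume fraction on \<open>K\<close>. Since cells have positive
  measure (\<open>cell_measure_pos\<close>), this increment vanishes, so the total keeps its value \<open>1\<close>.
\<close>

lemma sum_antisymmetric_exchange_eq_0:
  fixes \<kappa> :: "'i \<Rightarrow> 'i \<Rightarrow> real" and a d :: "'i \<Rightarrow> real"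
  assumes "finite I"
    and sym: "\<And>i j. i \<in> I \<Longrightarrow> j \<in> I \<Longrightarrow> i \<noteq> j \<Longrightarrow> \<kappa> i j = \<kappa> j i"
  shows "(\<Sum>i\<in>I. \<Sum>j\<in>I - {i}. \<kappa> i j * (a j * d i - a i * d j)) = 0"
proof -
  define g where "g i j = \<kappa> i j * (a j * d i - a i * d j)" for i j
  have antisym: "g i j = - g j i" if "i \<in> I" "j \<in> I" for i j
    using sym[OF that] by (cases "i = j") (auto simp: g_def algebra_simps)
  \<comment> \<open>The diagonal terms vanish, so the sum may be taken over the full square \<open>I \<times> I\<close>.\<close>
  have diag: "(\<Sum>j\<in>I - {i}. g i j) = (\<Sum>j\<in>I. g i j)" if "i \<in> I" for i
    using sum.remove[OF \<open>finite I\<close> that, of "g i"] by (simp add: g_def[of i i])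
  have "(\<Sum>i\<in>I. \<Sum>j\<in>I. g i j) = (\<Sum>j\<in>I. \<Sum>i\<in>I. g i j)"
    by (rule sum.swap)
  also have "\<dots> = (\<Sum>j\<in>I. \<Sum>i\<in>I. - g j i)"
    by (intro sum.cong refl antisym)
  also have "\<dots> = - (\<Sum>i\<in>I. \<Sum>j\<in>I. g i j)"
    by (simp add: sum_negf)
  finally have "(\<Sum>i\<in>I. \<Sum>j\<in>I. g i j) = 0"
    by simp
  then have "(\<Sum>i\<in>I. \<Sum>j\<in>I - {i}. g i j) = 0"
    using diag by simp
  then show ?thesis
    by (simp add: g_def)
qed

text \<open>
  The flux of species \<open>0\<close> has the same exchange part as the other species, since
  \<open>{1..n} = {0..n} - {0}\<close> and \<open>\<kappa> j 0 = \<kappa> 0 j\<close>. The exchange parts therefore cancel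
  pairwise, and the drift of species \<open>0\<close> balances the drifts of the others.
\<close>

lemma sum_flux_eq_0:
  fixes M :: "'d::finite mesh"
  assumes sym: "\<And>i j. i \<le> n \<Longrightarrow> j \<le> n \<Longrightarrow> i \<noteq> j \<Longrightarrow> \<kappa> i j = \<kappa> j i"
  shows "(\<Sum>i=0..n. flux M n \<kappa> V W i K \<sigma>) = 0"
proof -
  let ?\<tau> = "transmissibility M \<sigma>"
  define a where "a i = edge_value M (V i) K \<sigma>" for i
  define d where "d i = face_diff M (V i) K \<sigma>" for i
  define w where "w = face_diff M W K \<sigma>"
  define exchange where
    "exchange i = (\<Sum>j\<in>{0..n} - {i}. \<kappa> i j * (a j * d i - a i * d j))" for i
  define drift where "drift i = \<kappa> i 0 * a i * a 0 * w" for i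
  have others: "{0..n} - {0} = {1..n}"
    by auto
  have "(\<Sum>j=1..n. \<kappa> j 0 * (a j * d 0 - a 0 * d j)) = exchange 0"
    unfolding exchange_def others using sym by (intro sum.cong) auto
  then have flux_0: "flux M n \<kappa> V W 0 K \<sigma> = - ?\<tau> * exchange 0 - ?\<tau> * (\<Sum>j=1..n. drift j)"
    by (simp add: flux_def a_def d_def w_def drift_def)
  have flux_pos: "flux M n \<kappa> V W i K \<sigma> = - ?\<tau> * exchange i + ?\<tau> * drift i" if "i \<in> {1..n}" for i
    using that by (simp add: flux_def a_def d_def w_def drift_def exchange_def mult.assoc)
  have split: "(\<Sum>i=0..n. f i) = f 0 + (\<Sum>i=1..n. f i)" for f :: "nat \<Rightarrow> real"
    by (simp add: sum.atLeast_Suc_atMost)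
  have "(\<Sum>i=1..n. flux M n \<kappa> V W i K \<sigma>) = (\<Sum>i=1..n. - ?\<tau> * exchange i + ?\<tau> * drift i)"
    by (intro sum.cong refl flux_pos)
  also have "\<dots> = - ?\<tau> * (\<Sum>i=1..n. exchange i) + ?\<tau> * (\<Sum>i=1..n. drift i)"
    by (simp only: sum.distrib sum_distrib_left)
  finally have "(\<Sum>i=0..n. flux M n \<kappa> V W i K \<sigma>) = - ?\<tau> * (\<Sum>i=0..n. exchange i)"
    unfolding split flux_0 by (simp add: distrib_left)
  also have "(\<Sum>i=0..n. exchange i) = 0"
    unfolding exchange_def using sym by (intro sum_antisymmetric_exchange_eq_0) auto
  finally show ?thesis
    by simp
qed

text \<open>
  Boundedness of the domain matters here: for a set of infinite Lebesgue measure the real-valued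
  \<open>measure\<close> would be \<open>0\<close>.
\<close>

lemma cell_measure_pos:
  fixes M :: "'d::finite mesh"
  assumes "admissible_mesh \<Omega> M" and "bounded \<Omega>" and "K \<in> cells M"
  shows "measure lebesgue K > 0"
proof -
  have "open K" and "K \<noteq> {}" and cover: "(\<Union>L\<in>cells M. closure L) = closure \<Omega>"
    using assms(1,3) by (simp_all add: admissible_mesh_def)
  have "K \<subseteq> closure \<Omega>"
    using cover closure_subset[of K] \<open>K \<in> cells M\<close> by blast
  then have "bounded K"
    using bounded_subset[OF bounded_closure[OF \<open>bounded \<Omega>\<close>]] by blast
  then have "K \<in> lmeasurable" and "\<not> negligible K"
    using lmeasurable_open open_not_negligible \<open>open K\<close> \<open>K \<noteq> {}\<close> by auto
  then have "measure lebesgue K \<noteq> 0"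
    using negligible_iff_measure by blast
  then show ?thesis
    by (simp add: zero_less_measure_iff)
qed

theorem lemma4p3:
  fixes \<Omega> :: "(real ^ 'd::finite) set"
    and M :: "'d mesh"
    and n p :: nat
    and \<epsilon> \<beta> :: real
    and \<kappa> :: "nat \<Rightarrow> nat \<Rightarrow> real"
    and \<Delta>t :: "nat \<Rightarrow> real"
    and U :: "nat \<Rightarrow> nat \<Rightarrow> (real ^ 'd) set \<Rightarrow> real"
  assumes "CARD('d) \<in> {1, 2, 3}"
    and "open \<Omega>" "connected \<Omega>" "\<Omega> \<noteq> {}" "bounded \<Omega>"
    and "n \<ge> 1" "\<epsilon> > 0" "\<beta> > 0"
    and "\<And>i j. i \<le> n \<Longrightarrow> j \<le> n \<Longrightarrow> i \<noteq> j \<Longrightarrow> \<kappa> i j = \<kappa> j i \<and> \<kappa> i j > 0"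
    and "admissible_mesh \<Omega> M"
    and "\<Delta>t p > 0"
    and "\<forall>K\<in>cells M. (\<Sum>j=0..n. U p j K) = 1"
    and "scheme_step M n \<kappa> \<epsilon> \<beta> (\<Delta>t p) (U p) (U (p + 1))"
  shows "\<forall>K\<in>cells M. (\<Sum>j=0..n. U (p + 1) j K) = 1"
proof
  fix K assume K: "K \<in> cells M"
  let ?m = "measure lebesgue K"
  let ?J = "flux M n \<kappa> (U (p + 1)) (potential M \<epsilon> \<beta> (U p) (U (p + 1)))"
  have sym: "\<kappa> i j = \<kappa> j i" if "i \<le> n" "j \<le> n" "i \<noteq> j" for i j
    using assms(9) that by blast
  have "(\<Sum>i=0..n. \<Sum>\<sigma>\<in>cell_int_faces M K. ?J i K \<sigma>)
      = (\<Sum>\<sigma>\<in>cell_int_faces M K. \<Sum>i=0..n. ?J i K \<sigma>)"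
    by (rule sum.swap)
  also have "\<dots> = 0"
    by (simp add: sum_flux_eq_0[OF sym])
  finally have no_net_flux: "(\<Sum>i=0..n. \<Sum>\<sigma>\<in>cell_int_faces M K. ?J i K \<sigma>) = 0" .
  have "0 = (\<Sum>i=0..n. ?m * ((U (p + 1) i K - U p i K) / \<Delta>t p)
      + (\<Sum>\<sigma>\<in>cell_int_faces M K. ?J i K \<sigma>))"
    using assms(13) K by (simp add: scheme_step_def)
  also have "\<dots> = (\<Sum>i=0..n. ?m * ((U (p + 1) i K - U p i K) / \<Delta>t p))"
    by (simp only: sum.distrib no_net_flux add_0_right)
  also have "\<dots> = ?m / \<Delta>t p * ((\<Sum>i=0..n. U (p + 1) i K) - (\<Sum>i=0..n. U p i K))"
    by (simp add: sum_distrib_left[symmetric] sum_divide_distrib[symmetric] sum_subtractf)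
  finally show "(\<Sum>j=0..n. U (p + 1) j K) = 1"
    using cell_measure_pos[OF assms(10,5) K] assms(11,12) K by simp
qed

end
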